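(* Let $A=\{a_{ij}\}$, $i=0,1,2,\ldots$, $j=0,1,2,\ldots$, be a double sequence of complex scalars and $g(z)=\sum_{i=0}^{\infty} g_i z^i$ a complex power series. For $z\in\mathbb{C}$ put $P_{A;g}(z)=\{a_{ij}\,g_{i+j}\,z^{i+j}\}_{i,j=0,1,2,\ldots}$. If $P_{A;g}(a)\in B_c$ for some complex number $a\neq 0$, then $P_{A;g}(z)\in B_c$ for all complex $z$ satisfying $|z|<|a|$.
   Context: Let $c$ be the space of convergent sequences of complex scalars (with the supremum norm) and $B_c$ the space of bounded linear maps of $c$ into $c$. A double sequence $B=\{b_{ij}\}$, $i=0,1,2,\ldots$, $j=0,1,2,\ldots$, of complex constants acts on $s=[s_1,s_2,\ldots]\in c$ by $B(s)_i=b_{i0}\lim_{k\to\infty}s_k+\sum_{j=1}^{\infty}b_{ij}s_j$ for each row index $i$. One writes $B\in B_c$ if this defines a bounded linear map of $c$ into $c$; equivalently, if (1) $\sup_{i}\sum_{j=0}^{\infty}|b_{ij}|<\infty$; (2) $\lim_{i\to\infty}b_{ij}$ exists for $j=1,2,\ldots$; (3) $\lim_{i\to\infty}\sum_{j=0}^{\infty}b_{ij}$ exists. The convention $z^0=1$ is used for all $z$, including $z=0$. *)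

theory Defs
  imports Complex_Main "HOL-Computational_Algebra.Formal_Power_Series"
begin

text \<open>
  A sequence \<open>s :: nat \<Rightarrow> complex\<close> encodes \<open>[s 0, s 1, \<dots>]\<close>. Inputs of a matrix map are written
  \<open>[s\<^sub>1, s\<^sub>2, \<dots>]\<close> in the literature, so \<open>s j\<close> here is \<open>s\<^sub>j\<^sub>+\<^sub>1\<close> there; outputs are indexed by the
  row index from 0.
\<close>

definition conv_seqs :: "(nat \<Rightarrow> complex) set"
  where "conv_seqs = {s. convergent s}"

text \<open>Convergent sequences are bounded, so the supremum is a genuine one on \<^const>\<open>conv_seqs\<close>.\<close>

definition sup_norm :: "(nat \<Rightarrow> complex) \<Rightarrow> real"
  where "sup_norm s = (SUP n. norm (s n))"

definition bounded_linear_conv :: "((nat \<Rightarrow> complex) \<Rightarrow> (nat \<Rightarrow> complex)) \<Rightarrow> bool"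
  where "bounded_linear_conv T \<longleftrightarrow>
    (\<forall>s\<in>conv_seqs. T s \<in> conv_seqs) \<and>
    (\<forall>s\<in>conv_seqs. \<forall>t\<in>conv_seqs. T (\<lambda>n. s n + t n) = (\<lambda>n. T s n + T t n)) \<and>
    (\<forall>\<alpha>. \<forall>s\<in>conv_seqs. T (\<lambda>n. \<alpha> * s n) = (\<lambda>n. \<alpha> * T s n)) \<and>
    (\<exists>K. \<forall>s\<in>conv_seqs. sup_norm (T s) \<le> K * sup_norm s)"

text \<open>Column 0 of the matrix multiplies the limit; column \<open>j + 1\<close> multiplies the entry \<open>s j\<close>.\<close>

definition matrix_map :: "(nat \<Rightarrow> nat \<Rightarrow> complex) \<Rightarrow> (nat \<Rightarrow> complex) \<Rightarrow> (nat \<Rightarrow> complex)"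
  where "matrix_map B s = (\<lambda>i. B i 0 * lim s + (\<Sum>j. B i (Suc j) * s j))"

text \<open>
  The map is only defined on all of \<^const>\<open>conv_seqs\<close> if every row series converges;
  this is required explicitly since \<^const>\<open>suminf\<close> is total.
\<close>

definition B_c :: "(nat \<Rightarrow> nat \<Rightarrow> complex) set"
  where "B_c = {B. (\<forall>s\<in>conv_seqs. \<forall>i. summable (\<lambda>j. B i (Suc j) * s j)) \<and>
                   bounded_linear_conv (matrix_map B)}"

definition P_matrix :: "(nat \<Rightarrow> nat \<Rightarrow> complex) \<Rightarrow> complex fps \<Rightarrow> complex \<Rightarrow> nat \<Rightarrow> nat \<Rightarrow> complex"
  where "P_matrix A g z = (\<lambda>i j. A i j * fps_nth g (i + j) * z ^ (i + j))"

end

theory Submission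
  imports Defs
begin

text \<open>
  Put \<open>w = z / a\<close>, so \<open>\<bar>w\<bar> < 1\<close>. Passing from the point \<open>a\<close> to the point \<open>z\<close> multiplies the entry
  \<open>(i, j)\<close> of the matrix by \<open>w ^ (i + j)\<close>. A matrix in \<^const>\<open>B_c\<close> has uniformly bounded entries
  (\<open>B_c_entries_bounded\<close>), so the entries at \<open>z\<close> are dominated by \<open>M * \<bar>w\<bar> ^ (i + j)\<close>. Any such
  matrix is in \<^const>\<open>B_c\<close> (\<open>B_c_if_geometric_decay\<close>): the factor \<open>\<bar>w\<bar> ^ j\<close> makes the rows absolutely
  summable with a common bound, while the factor \<open>\<bar>w\<bar> ^ i\<close> forces every image sequence to tend
  to \<open>0\<close>.
\<close>

lemma norm_le_sup_norm:
  assumes "s \<in> conv_seqs"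
  shows "norm (s n) \<le> sup_norm s"
proof -
  have "Bseq s"
    using assms by (simp add: conv_seqs_def convergent_imp_Bseq)
  then have "bdd_above (range (\<lambda>n. norm (s n)))"
    by (auto simp: Bseq_def bdd_above_def)
  then show ?thesis
    unfolding sup_norm_def by (rule cSUP_upper[rotated]) simp
qed

lemma sup_norm_le:
  assumes "\<And>n. norm (s n) \<le> C"
  shows "sup_norm s \<le> C"
  unfolding sup_norm_def using assms by (intro cSUP_least) auto

text \<open>
  The entries in the columns \<open>Suc j\<close> are images of unit sequences. Column \<open>0\<close> cannot be isolated by a
  single convergent sequence; the indicator of \<open>{N..}\<close> has limit \<open>1\<close> and norm \<open>1\<close>, and its image in
  row \<open>i\<close> is \<open>B i 0\<close> plus a tail of the row series, which vanishes as \<open>N\<close> grows.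
\<close>

lemma B_c_entries_bounded:
  assumes "B \<in> B_c"
  obtains M where "\<And>i j. norm (B i j) \<le> M"
proof -
  from assms have
    summ: "\<And>s i. s \<in> conv_seqs \<Longrightarrow> summable (\<lambda>j. B i (Suc j) * s j)"
    and conv: "\<And>s. s \<in> conv_seqs \<Longrightarrow> matrix_map B s \<in> conv_seqs"
    and "\<exists>K. \<forall>s\<in>conv_seqs. sup_norm (matrix_map B s) \<le> K * sup_norm s"
    unfolding B_c_def bounded_linear_conv_def by auto
  then obtain K where
    K: "\<And>s. s \<in> conv_seqs \<Longrightarrow> sup_norm (matrix_map B s) \<le> K * sup_norm s"
    by blast
  have K0: "norm (matrix_map B s i) \<le> \<bar>K\<bar>"
    if s: "s \<in> conv_seqs" and s1: "\<And>n. norm (s n) \<le> 1" for s i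
  proof -
    have nonneg: "0 \<le> sup_norm s"
      using norm_le_sup_norm[OF s, of 0] norm_ge_zero[of "s 0"] by linarith
    have "norm (matrix_map B s i) \<le> sup_norm (matrix_map B s)"
      by (rule norm_le_sup_norm[OF conv[OF s]])
    also have "\<dots> \<le> K * sup_norm s"
      by (rule K[OF s])
    also have "\<dots> \<le> \<bar>K\<bar> * 1"
      using nonneg sup_norm_le[OF s1] by (intro mult_mono) auto
    finally show ?thesis by simp
  qed
  have Suc_col: "norm (B i (Suc j)) \<le> \<bar>K\<bar>" for i j
  proof -
    define e where "e = (\<lambda>n. if n = j then 1 else 0 :: complex)"
    have "e \<longlonglongrightarrow> 0"
      by (rule tendsto_eventually, rule eventually_sequentiallyI[of "Suc j"]) (auto simp: e_def)
    then have "lim e = 0" "e \<in> conv_seqs"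
      by (auto simp: limI conv_seqs_def convergent_def)
    moreover have "(\<lambda>k. B i (Suc k) * e k) sums B i (Suc j)"
      using sums_single[of j "\<lambda>k. B i (Suc k)"]
      by (simp add: e_def if_distrib cong: if_cong)
    ultimately have "matrix_map B e i = B i (Suc j)"
      by (simp add: matrix_map_def sums_iff)
    then show ?thesis
      using K0[OF \<open>e \<in> conv_seqs\<close>, of i] by (simp add: e_def)
  qed
  have col_0: "norm (B i 0) \<le> \<bar>K\<bar>" for i
  proof -
    define f where "f = (\<lambda>j. B i (Suc j))"
    have "(\<lambda>_. 1) \<in> conv_seqs"
      by (simp add: conv_seqs_def convergent_const)
    then have f: "summable f"
      using summ[of "\<lambda>_. 1" i] by (simp add: f_def)
    have bound: "norm (B i 0 + (suminf f - sum f {..<N})) \<le> \<bar>K\<bar>" for N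
    proof -
      define s where "s = (\<lambda>n. if n < N then 0 else 1 :: complex)"
      have "s \<longlonglongrightarrow> 1"
        by (rule tendsto_eventually, rule eventually_sequentiallyI[of N]) (auto simp: s_def)
      then have "lim s = 1" "s \<in> conv_seqs"
        by (auto simp: limI conv_seqs_def convergent_def)
      moreover have "(\<lambda>j. f j - (if j \<in> {..<N} then f j else 0)) sums (suminf f - sum f {..<N})"
        by (intro sums_diff summable_sums f sums_If_finite_set) simp
      then have "(\<lambda>j. B i (Suc j) * s j) sums (suminf f - sum f {..<N})"
        by (rule sums_cong[THEN iffD1, rotated]) (simp add: f_def s_def)
      ultimately have "matrix_map B s i = B i 0 + (suminf f - sum f {..<N})"
        by (simp add: matrix_map_def sums_iff)
      then show ?thesis
        using K0[OF \<open>s \<in> conv_seqs\<close>, of i] by (simp add: s_def)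
    qed
    have "(\<lambda>N. norm (B i 0 + (suminf f - sum f {..<N}))) \<longlonglongrightarrow> norm (B i 0 + (suminf f - suminf f))"
      by (intro tendsto_intros summable_LIMSEQ f)
    then have "norm (B i 0 + (suminf f - suminf f)) \<le> \<bar>K\<bar>"
      by (rule LIMSEQ_le_const2) (use bound in blast)
    then show ?thesis by simp
  qed
  have "norm (B i j) \<le> \<bar>K\<bar>" for i j
    using Suc_col col_0 by (cases j) auto
  then show ?thesis by (rule that)
qed

text \<open>
  Domination by a double geometric sequence gives
  \<open>\<bar>C(s)\<^sub>i\<bar> \<le> M * r ^ i * \<parallel>s\<parallel> * (1 + r + r^2 + \<dots>)\<close>. This single estimate yields both the operator bound
  \<open>M / (1 - r)\<close> and the convergence of the image, to \<open>0\<close>.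
\<close>

lemma B_c_if_geometric_decay:
  assumes decay: "\<And>i j. norm (C i j) \<le> M * r ^ (i + j)" and r: "0 \<le> r" "r < 1"
  shows "C \<in> B_c"
proof -
  have M: "0 \<le> M"
    using decay[of 0 0] norm_ge_zero[of "C 0 0"] by (simp del: norm_ge_zero)
  have geom: "(\<lambda>j. r ^ Suc j) sums (r / (1 - r))"
    using sums_mult[OF geometric_sums[of r], of r] r by simp
  have entry: "norm (C i (Suc j) * s j) \<le> M * r ^ i * sup_norm s * r ^ Suc j"
    if s: "s \<in> conv_seqs" for s i j
  proof -
    have "norm (C i (Suc j)) * norm (s j) \<le> (M * r ^ (i + Suc j)) * sup_norm s"
      using M r norm_le_sup_norm[OF s] by (intro mult_mono decay) auto
    then show ?thesis
      by (simp add: norm_mult power_add mult_ac)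
  qed
  have row_sums: "(\<lambda>j. M * r ^ i * sup_norm s * r ^ Suc j) sums
      (M * r ^ i * sup_norm s * (r / (1 - r)))" for s i
    by (rule sums_mult[OF geom])
  have summ: "summable (\<lambda>j. C i (Suc j) * s j)" if s: "s \<in> conv_seqs" for s i
    by (rule summable_comparison_test'[OF sums_summable[OF row_sums[of i s]]])
      (rule entry[OF s])
  have est: "norm (matrix_map C s i) \<le> M / (1 - r) * sup_norm s * r ^ i"
    if s: "s \<in> conv_seqs" for s i
  proof -
    have "s \<longlonglongrightarrow> lim s"
      using s by (simp add: conv_seqs_def convergent_LIMSEQ_iff)
    then have "norm (lim s) \<le> sup_norm s"
      by (intro LIMSEQ_le_const2[OF tendsto_norm]) (use norm_le_sup_norm[OF s] in auto)
    then have "norm (C i 0 * lim s) \<le> M * r ^ i * sup_norm s"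
      using decay[of i 0] M r unfolding norm_mult by (intro mult_mono) auto
    moreover have "norm (\<Sum>j. C i (Suc j) * s j) \<le> M * r ^ i * sup_norm s * (r / (1 - r))"
      unfolding sums_unique[OF row_sums]
      by (rule norm_suminf_le[OF entry[OF s] sums_summable[OF row_sums]])
    ultimately have "norm (matrix_map C s i) \<le>
        M * r ^ i * sup_norm s + M * r ^ i * sup_norm s * (r / (1 - r))"
      unfolding matrix_map_def by (rule norm_triangle_mono)
    also have "\<dots> = M / (1 - r) * sup_norm s * r ^ i"
      using r by (simp add: field_simps)
    finally show ?thesis .
  qed
  have "matrix_map C s \<in> conv_seqs" if s: "s \<in> conv_seqs" for s
  proof -
    have "(\<lambda>i. M / (1 - r) * sup_norm s * r ^ i) \<longlonglongrightarrow> 0"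
      using r by (intro tendsto_mult_right_zero LIMSEQ_power_zero) simp
    then have "(\<lambda>i. norm (matrix_map C s i)) \<longlonglongrightarrow> 0"
      by (rule tendsto_sandwich[OF _ _ tendsto_const, rotated -1]) (use est[OF s] in simp_all)
    then have "matrix_map C s \<longlonglongrightarrow> 0"
      by (rule tendsto_norm_zero_cancel)
    then show ?thesis
      by (auto simp: conv_seqs_def convergent_def)
  qed
  moreover have "matrix_map C (\<lambda>n. s n + t n) = (\<lambda>n. matrix_map C s n + matrix_map C t n)"
    if s: "s \<in> conv_seqs" and t: "t \<in> conv_seqs" for s t
  proof -
    have "lim (\<lambda>n. s n + t n) = lim s + lim t"
      using s t by (intro limI tendsto_add) (auto simp: conv_seqs_def convergent_LIMSEQ_iff)
    then show ?thesis
      using suminf_add[OF summ[OF s] summ[OF t]]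
      by (simp add: matrix_map_def fun_eq_iff algebra_simps)
  qed
  moreover have "matrix_map C (\<lambda>n. \<alpha> * s n) = (\<lambda>n. \<alpha> * matrix_map C s n)"
    if s: "s \<in> conv_seqs" for \<alpha> s
  proof -
    have "lim (\<lambda>n. \<alpha> * s n) = \<alpha> * lim s"
      using s by (intro limI tendsto_mult_left) (auto simp: conv_seqs_def convergent_LIMSEQ_iff)
    then show ?thesis
      using suminf_mult[OF summ[OF s], of \<alpha>]
      by (simp add: matrix_map_def fun_eq_iff algebra_simps)
  qed
  moreover have "sup_norm (matrix_map C s) \<le> M / (1 - r) * sup_norm s"
    if s: "s \<in> conv_seqs" for s
  proof (rule sup_norm_le)
    fix i
    have "0 \<le> sup_norm s"
      using norm_le_sup_norm[OF s, of 0] norm_ge_zero[of "s 0"] by linarith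
    then have "M / (1 - r) * sup_norm s * r ^ i \<le> M / (1 - r) * sup_norm s"
      using M r by (intro mult_left_le power_le_one) auto
    then show "norm (matrix_map C s i) \<le> M / (1 - r) * sup_norm s"
      using est[OF s, of i] by linarith
  qed
  ultimately show ?thesis
    using summ unfolding B_c_def bounded_linear_conv_def by blast
qed

theorem proposition2:
  fixes A :: "nat \<Rightarrow> nat \<Rightarrow> complex" and g :: "complex fps" and a :: complex
  assumes "a \<noteq> 0" and "P_matrix A g a \<in> B_c"
  shows "\<forall>z::complex. norm z < norm a \<longrightarrow> P_matrix A g z \<in> B_c"
proof (intro allI impI)
  fix z :: complex
  assume z: "norm z < norm a"
  obtain M where M: "\<And>i j. norm (P_matrix A g a i j) \<le> M"
    using B_c_entries_bounded[OF assms(2)] by blast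
  show "P_matrix A g z \<in> B_c"
  proof (rule B_c_if_geometric_decay)
    fix i j
    have "P_matrix A g z i j = P_matrix A g a i j * (z / a) ^ (i + j)"
      using assms(1) by (simp add: P_matrix_def power_divide)
    then have "norm (P_matrix A g z i j) = norm (P_matrix A g a i j) * norm (z / a) ^ (i + j)"
      by (simp only: norm_mult norm_power)
    also have "\<dots> \<le> M * norm (z / a) ^ (i + j)"
      by (intro mult_right_mono M) simp
    finally show "norm (P_matrix A g z i j) \<le> M * norm (z / a) ^ (i + j)" .
  next
    show "norm (z / a) < 1"
      using z assms(1) by (simp add: norm_divide)
  qed simp
qed

end
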